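(* Let $S$ be a finite nonempty semigroup which is $K$-thin. Then there is a homotopy equivalence $BS \simeq B(GS)$, where $GS$ is the group completion of $S$.
   Context: For a semigroup $S$, the classifying space $BS$ is the geometric realization of the $\Delta$-set whose $n$-simplices are the $n$-tuples $(x_1,\dots,x_n)\in S^n$, with face maps $d_0(x_1,\dots,x_n)=(x_2,\dots,x_n)$, $d_i(x_1,\dots,x_n)=(x_1,\dots,x_{i-1},x_ix_{i+1},x_{i+2},\dots,x_n)$ for $0<i<n$, and $d_n(x_1,\dots,x_n)=(x_1,\dots,x_{n-1})$. (For a group this is the usual classifying space up to homotopy.) The group completion $GS$ is the image of $S$ under the left adjoint of the forgetful functor from groups to semigroups. For a finite nonempty semigroup $S$, the minimal ideal $K(S)$ is the intersection of all nonempty two-sided ideals of $S$; it is nonempty. A Rees matrix semigroup $\mathcal{M}(H;I,J;p)$, for sets $I,J$, a group $H$ and a function $p\colon J\times I\to H$, is the set $I\times H\times J$ with product $(i,h,j)(i',h',j')=(i,h\,p(j,i')\,h',j')$. It is known that $K(S)$ is always isomorphic to a Rees matrix semigroup $\mathcal{M}(H;I,J;p)$ with $H$ a finite group, normalized in the sense that for some $i_0\in I$, $j_0\in J$ one has $p(j_0,i)=e_H$ for all $i$ and $p(j,i_0)=e_H$ for all $j$. $S$ is called $K$-thin if $K(S)$ has such a normalized Rees matrix structure with $|I|=1$ or $|J|=1$; equivalently, $K(S)$ is left-simple or right-simple (has no proper nonempty left ideals, resp. right ideals, as a semigroup). *)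

theory Defs
  imports "HOL-Homology.Homology"
begin

definition is_semigroup :: "'a set \<Rightarrow> ('a \<Rightarrow> 'a \<Rightarrow> 'a) \<Rightarrow> bool" where
  "is_semigroup A m \<longleftrightarrow> (\<forall>x\<in>A. \<forall>y\<in>A. m x y \<in> A) \<and>
     (\<forall>x\<in>A. \<forall>y\<in>A. \<forall>z\<in>A. m (m x y) z = m x (m y z))"

definition is_ideal :: "'a set \<Rightarrow> ('a \<Rightarrow> 'a \<Rightarrow> 'a) \<Rightarrow> 'a set \<Rightarrow> bool" where
  "is_ideal A m I \<longleftrightarrow> I \<subseteq> A \<and> (\<forall>s\<in>A. \<forall>x\<in>I. m s x \<in> I \<and> m x s \<in> I)"

definition minimal_ideal :: "'a set \<Rightarrow> ('a \<Rightarrow> 'a \<Rightarrow> 'a) \<Rightarrow> 'a set" where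
  "minimal_ideal A m = \<Inter> {I. is_ideal A m I \<and> I \<noteq> {}}"

definition left_simple :: "'a set \<Rightarrow> ('a \<Rightarrow> 'a \<Rightarrow> 'a) \<Rightarrow> bool" where
  "left_simple K m \<longleftrightarrow>
     (\<forall>L. L \<subseteq> K \<and> L \<noteq> {} \<and> (\<forall>k\<in>K. \<forall>x\<in>L. m k x \<in> L) \<longrightarrow> L = K)"

definition right_simple :: "'a set \<Rightarrow> ('a \<Rightarrow> 'a \<Rightarrow> 'a) \<Rightarrow> bool" where
  "right_simple K m \<longleftrightarrow>
     (\<forall>R. R \<subseteq> K \<and> R \<noteq> {} \<and> (\<forall>k\<in>K. \<forall>x\<in>R. m x k \<in> R) \<longrightarrow> R = K)"

definition K_thin :: "'a set \<Rightarrow> ('a \<Rightarrow> 'a \<Rightarrow> 'a) \<Rightarrow> bool" where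
  "K_thin A m \<longleftrightarrow> left_simple (minimal_ideal A m) m \<or> right_simple (minimal_ideal A m) m"

text \<open>Face maps of the Delta-set of S: n-simplices are lists of length n over A.\<close>

definition face :: "('a \<Rightarrow> 'a \<Rightarrow> 'a) \<Rightarrow> nat \<Rightarrow> 'a list \<Rightarrow> 'a list" where
  "face m i xs =
     (if i = 0 then tl xs
      else if i = length xs then butlast xs
      else take (i - 1) xs @ [m (xs ! (i - 1)) (xs ! i)] @ drop (i + 1) xs)"

definition quotient_top :: "'a topology \<Rightarrow> ('a \<Rightarrow> 'b) \<Rightarrow> 'b topology" where
  "quotient_top X q = topology (\<lambda>U. U \<subseteq> q ` topspace X \<and> openin X {x \<in> topspace X. q x \<in> U})"

definition simplices_top :: "'a set \<Rightarrow> ('a list \<times> (nat \<Rightarrow> real)) topology" where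
  "simplices_top A = sum_topology
     (\<lambda>xs. subtopology (powertop_real UNIV) (standard_simplex (length xs))) (lists A)"

definition face_ident :: "'a set \<Rightarrow> ('a \<Rightarrow> 'a \<Rightarrow> 'a) \<Rightarrow>
    (('a list \<times> (nat \<Rightarrow> real)) \<times> ('a list \<times> (nat \<Rightarrow> real))) set" where
  "face_ident A m = {((face m i xs, t), (xs, simplical_face i t)) | xs i t.
      xs \<in> lists A \<and> 1 \<le> length xs \<and> i \<le> length xs \<and> t \<in> standard_simplex (length xs - 1)}"

definition realization_rel :: "'a set \<Rightarrow> ('a \<Rightarrow> 'a \<Rightarrow> 'a) \<Rightarrow>
    (('a list \<times> (nat \<Rightarrow> real)) \<times> ('a list \<times> (nat \<Rightarrow> real))) set" where
  "realization_rel A m = Id_on (topspace (simplices_top A)) \<union>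
      (face_ident A m \<union> (face_ident A m)\<inverse>)\<^sup>+"

definition classifying_space :: "'a set \<Rightarrow> ('a \<Rightarrow> 'a \<Rightarrow> 'a) \<Rightarrow>
    ('a list \<times> (nat \<Rightarrow> real)) set topology" where
  "classifying_space A m = quotient_top (simplices_top A) (\<lambda>p. realization_rel A m `` {p})"

text \<open>Group completion GS: words in letters (s, b) (b = False meaning the formal inverse),
  modulo the congruence generated by  (s,+)(s',+) = (s s',+)  and  (s,b)(s,\<not>b) = 1.\<close>

definition gc_words :: "'a set \<Rightarrow> ('a \<times> bool) list set" where
  "gc_words A = lists (A \<times> UNIV)"

inductive_set gc_step :: "'a set \<Rightarrow> ('a \<Rightarrow> 'a \<Rightarrow> 'a) \<Rightarrow> (('a \<times> bool) list \<times> ('a \<times> bool) list) set"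
  for A m where
  mult: "\<lbrakk>u \<in> gc_words A; v \<in> gc_words A; x \<in> A; y \<in> A\<rbrakk> \<Longrightarrow>
          (u @ [(x, True), (y, True)] @ v, u @ [(m x y, True)] @ v) \<in> gc_step A m"
| cancel: "\<lbrakk>u \<in> gc_words A; v \<in> gc_words A; x \<in> A\<rbrakk> \<Longrightarrow>
          (u @ [(x, b), (x, \<not> b)] @ v, u @ v) \<in> gc_step A m"

definition gc_eq :: "'a set \<Rightarrow> ('a \<Rightarrow> 'a \<Rightarrow> 'a) \<Rightarrow> (('a \<times> bool) list \<times> ('a \<times> bool) list) set" where
  "gc_eq A m = Id_on (gc_words A) \<union> (gc_step A m \<union> (gc_step A m)\<inverse>)\<^sup>+"

definition gc_carrier :: "'a set \<Rightarrow> ('a \<Rightarrow> 'a \<Rightarrow> 'a) \<Rightarrow> ('a \<times> bool) list set set" where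
  "gc_carrier A m = gc_words A // gc_eq A m"

definition gc_mult :: "'a set \<Rightarrow> ('a \<Rightarrow> 'a \<Rightarrow> 'a) \<Rightarrow>
    ('a \<times> bool) list set \<Rightarrow> ('a \<times> bool) list set \<Rightarrow> ('a \<times> bool) list set" where
  "gc_mult A m P Q = (\<Union>u\<in>P. \<Union>v\<in>Q. gc_eq A m `` {u @ v})"

end

theory Submission
  imports Defs "HOL-Analysis.Analysis"
begin

text \<open>
  The minimal ideal of a \<open>K\<close>-thin finite semigroup \<open>S\<close> contains an idempotent \<open>e\<close> such that
  \<open>\<phi> x = e x e\<close> equals \<open>e x\<close> for all \<open>x\<close> (left-simple case) or \<open>x e\<close> for all \<open>x\<close> (right-simple
  case). Hence \<open>\<phi>\<close> is a homomorphic retraction of \<open>S\<close> onto the group \<open>e S e\<close>. Since \<open>e\<close> becomes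
  trivial in \<open>GS\<close>, evaluating words in \<open>e S e\<close> gives a homomorphism \<open>GS \<rightarrow> S\<close> that is a section of
  \<open>S \<rightarrow> GS\<close>, and the other composite is \<open>\<phi>\<close>. It remains to see that \<open>\<phi>\<close> is homotopic to the
  identity on \<open>BS\<close>. Now \<open>\<phi> x \<cdot> e = e \<cdot> x\<close> or \<open>x \<cdot> e = e \<cdot> \<phi> x\<close>, so \<open>e\<close> plays the role of a natural
  transformation, and the usual prism decomposition of \<open>\<Delta>\<^sup>n \<times> [0,1]\<close> yields a homotopy that needs
  no degenerate simplices.
\<close>

subsection \<open>Realizations and induced maps\<close>

lemma equiv_Id_on_Un_trancl:
  assumes "R \<subseteq> T \<times> T"
  shows "equiv T (Id_on T \<union> (R \<union> R\<inverse>)\<^sup>+)"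
proof (rule equivI)
  have sub: "(R \<union> R\<inverse>)\<^sup>+ \<subseteq> T \<times> T"
    using assms by (intro trancl_subset_Sigma) auto
  then show "Id_on T \<union> (R \<union> R\<inverse>)\<^sup>+ \<subseteq> T \<times> T" by auto
  show "refl_on T (Id_on T \<union> (R \<union> R\<inverse>)\<^sup>+)"
    by (auto simp: refl_on_def)
  show "sym (Id_on T \<union> (R \<union> R\<inverse>)\<^sup>+)"
    by (rule sym_Un[OF sym_Id_on sym_trancl[OF sym_Un_converse]])
  show "trans (Id_on T \<union> (R \<union> R\<inverse>)\<^sup>+)"
    unfolding trans_def by (blast intro: trancl_trans)
qed

text \<open>\<open>realization_rel\<close> and \<open>gc_eq\<close> both have this shape, so a map
  descends to either quotient once it respects the generating pairs.\<close>

lemma eq_if_Id_on_Un_trancl: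
  assumes "(x, y) \<in> Id_on T \<union> (R \<union> R\<inverse>)\<^sup>+"
    and eq: "\<And>x y. (x, y) \<in> R \<Longrightarrow> h x = h y"
  shows "h x = h y"
proof -
  have "h x = h y" if "(x, y) \<in> (R \<union> R\<inverse>)\<^sup>+"
    using that by induction (auto dest: eq)
  then show ?thesis using assms(1) by auto
qed

lemma quotient_map_quotient_top: "quotient_map X (quotient_top X q) q"
proof -
  \<comment> \<open>\<open>topology\<close> inverts \<open>openin\<close> only on predicates that
    satisfy \<open>istopology\<close>.\<close>
  have "istopology (\<lambda>U. U \<subseteq> q ` topspace X \<and> openin X {x \<in> topspace X. q x \<in> U})"
  proof -
    have "{x \<in> topspace X. q x \<in> S \<inter> T} = {x \<in> topspace X. q x \<in> S} \<inter> {x \<in> topspace X. q x \<in> T}"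
      for S T by auto
    moreover have "{x \<in> topspace X. q x \<in> \<Union>K} = (\<Union>S\<in>K. {x \<in> topspace X. q x \<in> S})" for K
      by auto
    ultimately show ?thesis
      unfolding istopology_def by auto
  qed
  then have op: "openin (quotient_top X q) U \<longleftrightarrow>
      U \<subseteq> q ` topspace X \<and> openin X {x \<in> topspace X. q x \<in> U}" for U
    by (simp add: quotient_top_def)
  have "{x \<in> topspace X. q x \<in> q ` topspace X} = topspace X" by auto
  then have "topspace (quotient_top X q) = q ` topspace X"
    using openin_subset[of "quotient_top X q" "q ` topspace X"] op openin_topspace
    by (metis order_antisym order_refl)
  then show ?thesis by (auto simp: quotient_map_def op)
qed

lemma continuous_map_from_sum:
  assumes "\<And>i. i \<in> I \<Longrightarrow> continuous_map (X i) Y (\<lambda>x. h (i, x))"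
  shows "continuous_map (sum_topology X I) Y h"
proof -
  have "openin (X i) {x. (i, x) \<in> {p \<in> Sigma I (topspace \<circ> X). h p \<in> U}}"
    if "openin Y U" "i \<in> I" for U i
    using that assms[of i] by (auto simp: continuous_map_def)
  then show ?thesis
    using assms by (auto simp: continuous_map_def openin_sum_topology Pi_iff)
qed

text \<open>Each summand is open in the sum, so an open box over one summand stays open in the whole
  product. Continuity of the homotopy can thus be checked one simplex at a time.\<close>

lemma continuous_map_from_prod_sum:
  assumes "\<And>i. i \<in> I \<Longrightarrow> continuous_map (prod_topology Z (X i)) Y (\<lambda>p. h (fst p, (i, snd p)))"
  shows "continuous_map (prod_topology Z (sum_topology X I)) Y h"
  unfolding continuous_map_def
proof (intro conjI allI impI)
  show "h \<in> topspace (prod_topology Z (sum_topology X I)) \<rightarrow> topspace Y"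
    using assms by (force simp: continuous_map_def Pi_iff)
next
  fix U assume U: "openin Y U"
  let ?W = "{p \<in> topspace (prod_topology Z (sum_topology X I)). h p \<in> U}"
  show "openin (prod_topology Z (sum_topology X I)) ?W"
    unfolding openin_prod_topology_alt
  proof (intro allI impI)
    fix z p assume zp: "(z, p) \<in> ?W"
    then obtain i x where p: "p = (i, x)" "i \<in> I" "x \<in> topspace (X i)" "z \<in> topspace Z" by auto
    let ?V = "{w \<in> topspace (prod_topology Z (X i)). h (fst w, (i, snd w)) \<in> U}"
    have "openin (prod_topology Z (X i)) ?V"
      using assms[OF p(2)] U by (auto simp: continuous_map_def)
    moreover have "(z, x) \<in> ?V" using zp p by auto
    ultimately obtain P Q where PQ: "openin Z P" "openin (X i) Q" "z \<in> P" "x \<in> Q" "P \<times> Q \<subseteq> ?V"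
      unfolding openin_prod_topology_alt by meson
    have "openin (sum_topology X I) (Pair i ` Q)"
      using open_map_component_injection[OF p(2), of X] PQ(2) by (auto simp: open_map_def)
    moreover have "P \<times> Pair i ` Q \<subseteq> ?W"
      using PQ p(2) by auto
    ultimately show "\<exists>U V. openin Z U \<and> openin (sum_topology X I) V \<and> z \<in> U \<and> p \<in> V \<and> U \<times> V \<subseteq> ?W"
      using PQ p(1) by blast
  qed
qed

section \<open>Faces of tuples\<close>

lemma face_0: "face m 0 (x # xs) = xs"
  by (simp add: face_def)

lemma face_last: "face m (Suc (length xs)) (xs @ [x]) = xs"
  by (simp add: face_def)

lemma face_mid: "face m (Suc (length xs)) (xs @ x # y # ys) = xs @ m x y # ys"
  by (simp add: face_def nth_append)

text \<open>Writing the tuple as a concatenation around the affected place turns identities between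
  faces into rewriting of lists.\<close>

lemma face_cases [consumes 2, case_names first last mid]:
  assumes "1 \<le> length xs" "i \<le> length xs"
  obtains x ys where "i = 0" "xs = x # ys"
    | x ys where "xs = ys @ [x]" "i = Suc (length ys)"
    | x y ys zs where "xs = ys @ x # y # zs" "i = Suc (length ys)"
proof -
  consider "i = 0" | "i = length xs" | "0 < i" "i < length xs" using assms by linarith
  then show ?thesis
  proof cases
    case 1 then show ?thesis using assms that(1) by (cases xs) auto
  next
    case 2 then show ?thesis using assms that(2) by (cases xs rule: rev_cases) auto
  next
    case 3
    then have "xs = take (i - 1) xs @ xs ! (i - 1) # xs ! i # drop (Suc i) xs"
      by (metis Cons_nth_drop_Suc Suc_diff_1 append_take_drop_id less_imp_diff_less)
    moreover have "i = Suc (length (take (i - 1) xs))" using 3 by simp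
    ultimately show ?thesis using that(3) by blast
  qed
qed

lemma length_face:
  assumes "1 \<le> length xs" "i \<le> length xs"
  shows "length (face m i xs) = length xs - 1"
  using assms by (cases rule: face_cases) (simp_all add: face_0 face_last face_mid)

lemma face_in_lists:
  assumes "is_semigroup A m" "xs \<in> lists A" "1 \<le> length xs" "i \<le> length xs"
  shows "face m i xs \<in> lists A"
  using assms(3,4,1,2)
  by (cases rule: face_cases) (auto simp: face_0 face_last face_mid is_semigroup_def)

definition semigroup_hom ::
    "'a set \<Rightarrow> ('a \<Rightarrow> 'a \<Rightarrow> 'a) \<Rightarrow> 'b set \<Rightarrow> ('b \<Rightarrow> 'b \<Rightarrow> 'b) \<Rightarrow> ('a \<Rightarrow> 'b) \<Rightarrow> bool" where
  "semigroup_hom A m B n f \<longleftrightarrow> f \<in> A \<rightarrow> B \<and> (\<forall>x\<in>A. \<forall>y\<in>A. f (m x y) = n (f x) (f y))"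

lemma map_face:
  assumes "semigroup_hom A m B n f" "xs \<in> lists A" "1 \<le> length xs" "i \<le> length xs"
  shows "map f (face m i xs) = face n i (map f xs)"
  using assms(3,4,1,2)
proof (cases rule: face_cases)
  case (last x ys)
  then show ?thesis using face_last[of n "map f ys" "f x"] by (simp add: face_last)
next
  case (mid x y ys zs)
  then show ?thesis using assms face_mid[of n "map f ys" "f x" "f y"]
    by (simp add: face_mid semigroup_hom_def)
qed (simp add: face_0)

section \<open>The realization and its functoriality\<close>

lemma topspace_simplices_top:
  "topspace (simplices_top A) = (SIGMA xs:lists A. standard_simplex (length xs))"
  by (simp add: simplices_top_def topspace_standard_simplex o_def)

abbreviation realization_class ::
    "'a set \<Rightarrow> ('a \<Rightarrow> 'a \<Rightarrow> 'a) \<Rightarrow> 'a list \<times> (nat \<Rightarrow> real) \<Rightarrow> ('a list \<times> (nat \<Rightarrow> real)) set" where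
  "realization_class A m p \<equiv> realization_rel A m `` {p}"

lemma quotient_map_realization_class:
  "quotient_map (simplices_top A) (classifying_space A m) (realization_class A m)"
  unfolding classifying_space_def by (rule quotient_map_quotient_top)

lemma equiv_realization_rel:
  assumes "is_semigroup A m"
  shows "equiv (topspace (simplices_top A)) (realization_rel A m)"
  unfolding realization_rel_def
proof (rule equiv_Id_on_Un_trancl, safe)
  fix a b c d assume "((a, b), (c, d)) \<in> face_ident A m"
  then obtain i where "a = face m i c" "d = simplical_face i b" "c \<in> lists A"
    "1 \<le> length c" "i \<le> length c" "b \<in> standard_simplex (length c - 1)"
    by (auto simp: face_ident_def)
  then show "(a, b) \<in> topspace (simplices_top A)" "(c, d) \<in> topspace (simplices_top A)"
    using face_in_lists[OF assms] simplical_face_in_standard_simplex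
    by (auto simp: topspace_simplices_top length_face)
qed

lemma realization_class_eq_iff:
  assumes "is_semigroup A m" "p \<in> topspace (simplices_top A)" "p' \<in> topspace (simplices_top A)"
  shows "realization_class A m p = realization_class A m p' \<longleftrightarrow> (p, p') \<in> realization_rel A m"
  using eq_equiv_class_iff[OF equiv_realization_rel[OF assms(1)] assms(2,3)] .

lemma realization_class_face:
  assumes "is_semigroup A m" "xs \<in> lists A" "1 \<le> length xs" "i \<le> length xs"
    "t \<in> standard_simplex (length xs - 1)"
  shows "realization_class A m (xs, simplical_face i t) = realization_class A m (face m i xs, t)"
proof -
  have "((face m i xs, t), (xs, simplical_face i t)) \<in> face_ident A m"
    using assms unfolding face_ident_def by blast
  then have "((face m i xs, t), (xs, simplical_face i t)) \<in> realization_rel A m"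
    unfolding realization_rel_def by blast
  from equiv_class_eq[OF equiv_realization_rel[OF assms(1)] this] show ?thesis by simp
qed

lemma realization_rel_cong:
  assumes "(p, p') \<in> realization_rel A m"
    and face: "\<And>xs i t. \<lbrakk>xs \<in> lists A; 1 \<le> length xs; i \<le> length xs; t \<in> standard_simplex (length xs - 1)\<rbrakk>
       \<Longrightarrow> h (face m i xs, t) = h (xs, simplical_face i t)"
  shows "h p = h p'"
  using assms(1) unfolding realization_rel_def
  by (rule eq_if_Id_on_Un_trancl) (auto simp: face_ident_def intro!: face)

text \<open>No representative is chosen. If \<open>f\<close> is a homomorphism and \<open>c\<close>
  a class, the images of all its representatives lie in one class, and the result is that
  class.\<close>

definition realization_map ::
    "'b set \<Rightarrow> ('b \<Rightarrow> 'b \<Rightarrow> 'b) \<Rightarrow> ('a \<Rightarrow> 'b) \<Rightarrow> ('a list \<times> (nat \<Rightarrow> real)) set \<Rightarrow> ('b list \<times> (nat \<Rightarrow> real)) set" where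
  "realization_map B n f c = realization_rel B n `` (map_prod (map f) id ` c)"

lemma map_in_lists: "\<lbrakk>semigroup_hom A m B n f; xs \<in> lists A\<rbrakk> \<Longrightarrow> map f xs \<in> lists B"
  by (auto simp: semigroup_hom_def Pi_iff)

lemma realization_map_class:
  assumes A: "is_semigroup A m" and B: "is_semigroup B n" and f: "semigroup_hom A m B n f"
    and p: "p \<in> topspace (simplices_top A)"
  shows "realization_map B n f (realization_class A m p) = realization_class B n (map_prod (map f) id p)"
proof -
  let ?h = "\<lambda>p. realization_class B n (map_prod (map f) id p)"
  have "?h p = ?h p'" if "p' \<in> realization_class A m p" for p'
  proof (rule realization_rel_cong[where h = ?h])
    show "(p, p') \<in> realization_rel A m" using that by simp
  next
    fix xs i and t :: "nat \<Rightarrow> real"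
    assume xs: "xs \<in> lists A" "1 \<le> length xs" "i \<le> length xs" "t \<in> standard_simplex (length xs - 1)"
    then show "?h (face m i xs, t) = ?h (xs, simplical_face i t)"
      using realization_class_face[OF B map_in_lists[OF f xs(1)], of i t]
      by (simp add: map_face[OF f])
  qed
  moreover have "p \<in> realization_class A m p"
    using equiv_class_self[OF equiv_realization_rel[OF A] p] .
  moreover have "realization_map B n f c = (\<Union>p'\<in>c. ?h p')" for c
    by (auto simp: realization_map_def)
  ultimately show ?thesis by blast
qed

lemma continuous_realization_map:
  assumes A: "is_semigroup A m" and B: "is_semigroup B n" and f: "semigroup_hom A m B n f"
  shows "continuous_map (classifying_space A m) (classifying_space B n) (realization_map B n f)"
proof -
  have "continuous_map (simplices_top A) (simplices_top B) (map_prod (map f) id)"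
    unfolding simplices_top_def
  proof (rule continuous_map_from_sum)
    fix xs assume "xs \<in> lists A"
    then have "map f xs \<in> lists B" by (rule map_in_lists[OF f])
    from continuous_map_component_injection[OF this,
        of "\<lambda>xs. subtopology (powertop_real UNIV) (standard_simplex (length xs))"]
    show "continuous_map (subtopology (powertop_real UNIV) (standard_simplex (length xs)))
      (sum_topology (\<lambda>xs. subtopology (powertop_real UNIV) (standard_simplex (length xs))) (lists B))
      (\<lambda>t. map_prod (map f) id (xs, t))" by simp
  qed
  then have "continuous_map (simplices_top A) (classifying_space B n)
      (realization_class B n \<circ> map_prod (map f) id)"
    using quotient_imp_continuous_map[OF quotient_map_realization_class]
    by (rule continuous_map_compose)
  then have "continuous_map (simplices_top A) (classifying_space B n)
      (realization_map B n f \<circ> realization_class A m)"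
    by (rule continuous_map_eq) (simp add: realization_map_class[OF assms])
  then show ?thesis
    using continuous_compose_quotient_map[OF quotient_map_realization_class] by blast
qed

lemma topspace_classifying_space:
  "topspace (classifying_space A m) = realization_class A m ` topspace (simplices_top A)"
  using quotient_map_realization_class quotient_imp_surjective_map by blast

text \<open>Agreement of \<open>h\<close> with the composite on A suffices; so evaluation after the
  unit can be read as the retraction, and the opposite composite as the identity.\<close>

lemma realization_map_comp:
  assumes A: "is_semigroup A m" and B: "is_semigroup B n" and C: "is_semigroup C l"
    and f: "semigroup_hom A m B n f" and g: "semigroup_hom B n C l g"
    and fg: "\<And>x. x \<in> A \<Longrightarrow> g (f x) = h x" and c: "c \<in> topspace (classifying_space A m)"
  shows "realization_map C l g (realization_map B n f c) = realization_map C l h c"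
proof -
  have h: "semigroup_hom A m C l h"
    using f g A by (auto simp: semigroup_hom_def is_semigroup_def Pi_iff simp flip: fg)
  obtain xs t where p: "c = realization_class A m (xs, t)" "(xs, t) \<in> topspace (simplices_top A)"
    using c by (auto simp: topspace_classifying_space simp del: Image_singleton_iff)
  then have "(map f xs, t) \<in> topspace (simplices_top B)"
    using map_in_lists[OF f, of xs] by (auto simp: topspace_simplices_top)
  moreover have "map g (map f xs) = map h xs"
    using p(2) fg by (auto simp: topspace_simplices_top)
  ultimately show ?thesis
    using p(2) realization_map_class[OF A B f p(2)] realization_map_class[OF A C h p(2)]
      realization_map_class[OF B C g, of "(map f xs, t)"]
    unfolding p(1) by (simp del: map_map)
qed

lemma realization_map_ident:
  assumes A: "is_semigroup A m" and id: "\<And>x. x \<in> A \<Longrightarrow> f x = x"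
    and c: "c \<in> topspace (classifying_space A m)"
  shows "realization_map A m f c = c"
proof -
  have f: "semigroup_hom A m A m f"
    using A by (auto simp: semigroup_hom_def id is_semigroup_def)
  obtain xs t where p: "c = realization_class A m (xs, t)" "(xs, t) \<in> topspace (simplices_top A)"
    using c by (auto simp: topspace_classifying_space simp del: Image_singleton_iff)
  then have "map f xs = xs"
    using id by (auto simp: topspace_simplices_top intro: map_idI)
  then show ?thesis using realization_map_class[OF A A f p(2)] p(1) by simp
qed

subsection \<open>Natural transformations induce homotopies\<close>

text \<open>
  A point \<open>(xs, t)\<close> of the realization is a subdivision of \<open>[0,1]\<close> into intervals of lengths
  \<open>t 0, t 1, \<dots>\<close> whose interior cut points are labelled by \<open>xs\<close>; labels of colliding points multiply,
  and points reaching \<open>0\<close> or \<open>1\<close> disappear. The homotopy at time \<open>r\<close> inserts a cut point at \<open>r\<close> with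
  label \<open>\<eta>\<close>, applies \<open>f\<close> to the labels on its left and \<open>g\<close> to those on its right. The index \<open>i\<close> is the
  number of old cut points on the left of \<open>r\<close>.
\<close>

definition prism_label :: "('a \<Rightarrow> 'b) \<Rightarrow> ('a \<Rightarrow> 'b) \<Rightarrow> 'b \<Rightarrow> nat \<Rightarrow> 'a list \<Rightarrow> 'b list" where
  "prism_label f g \<eta> i xs = map f (take i xs) @ \<eta> # map g (drop i xs)"

definition prism_coord :: "nat \<Rightarrow> real \<Rightarrow> (nat \<Rightarrow> real) \<Rightarrow> nat \<Rightarrow> real" where
  "prism_coord i r t = (\<lambda>j. if j < i then t j else if j = i then r - sum t {..<i}
     else if j = Suc i then sum t {..<Suc i} - r else t (j - 1))"

lemma length_prism_label [simp]: "length (prism_label f g \<eta> i xs) = Suc (length xs)"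
  by (simp add: prism_label_def)

lemma prism_coord_in_simplex:
  assumes t: "t \<in> standard_simplex n" and "i \<le> n" and r: "sum t {..<i} \<le> r" "r \<le> sum t {..<Suc i}"
  shows "prism_coord i r t \<in> standard_simplex (Suc n)"
proof -
  have t01: "0 \<le> t j" "t j \<le> 1" for j using t by (auto simp: standard_simplex_def)
  \<comment> \<open>The two pieces of interval \<open>i\<close> add up to \<open>t i\<close>, so
    from there on the partial sums agree up to a shift by one.\<close>
  have "sum (prism_coord i r t) {..Suc k} = sum t {..k}" if "i \<le> k" for k
    using that
  proof (induction k rule: dec_induct)
    case base
    have "sum (prism_coord i r t) {..<i} = sum t {..<i}"
      by (simp add: prism_coord_def)
    then show ?case
      by (simp add: lessThan_Suc_atMost[symmetric]) (simp add: prism_coord_def)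
  next
    case (step k)
    then show ?case by (simp add: prism_coord_def)
  qed
  from this[OF \<open>i \<le> n\<close>] have "sum (prism_coord i r t) {..Suc n} = 1"
    using t by (simp add: standard_simplex_def)
  moreover have "0 \<le> prism_coord i r t j" "prism_coord i r t j \<le> 1" for j
    using t01[of j] t01[of "j - 1"] t01[of i] r by (auto simp: prism_coord_def)
  moreover have "prism_coord i r t j = 0" if "j > Suc n" for j
    using that t \<open>i \<le> n\<close> by (auto simp: prism_coord_def standard_simplex_def)
  ultimately show ?thesis by (simp add: standard_simplex_def)
qed

text \<open>\<open>simplical_face k\<close> inserts a zero at position \<open>k\<close>: the
  endpoints of the intervals stay in place, one of them being repeated.\<close>

lemma sum_simplical_face:
  "sum (simplical_face k t) {..<j} = sum t {..<if j \<le> k then j else j - 1}"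
proof (induction j)
  case (Suc j)
  show ?case
  proof (cases "j \<le> k")
    case True
    then show ?thesis using Suc by (auto simp: simplical_face_def)
  next
    case False
    then obtain i where "j = Suc i" by (cases j) auto
    then show ?thesis using Suc False by (auto simp: simplical_face_def)
  qed
qed simp

text \<open>An empty interval inserted at or before interval \<open>i\<close> moves the interval
  being cut to index \<open>Suc i\<close>. One inserted later, as in
  \<open>prism_coord_face_gt\<close>, is itself moved by the cut.\<close>

lemma prism_coord_face_le:
  assumes "k \<le> i"
  shows "prism_coord (Suc i) r (simplical_face k t) = simplical_face k (prism_coord i r t)"
proof
  fix j
  show "prism_coord (Suc i) r (simplical_face k t) j = simplical_face k (prism_coord i r t) j"
    using assms unfolding prism_coord_def sum_simplical_face
    by (auto simp: simplical_face_def)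
qed

lemma prism_coord_face_gt:
  assumes "i < k"
  shows "prism_coord i r (simplical_face k t) = simplical_face (Suc k) (prism_coord i r t)"
proof
  fix j
  show "prism_coord i r (simplical_face k t) j = simplical_face (Suc k) (prism_coord i r t) j"
    using assms unfolding prism_coord_def sum_simplical_face
    by (auto simp: simplical_face_def)
qed

text \<open>When \<open>r\<close> is an endpoint of interval \<open>i\<close>, one of its two pieces
  has length zero and the point lies on a face of the prism. Such faces are where neighbouring
  prisms meet and where the homotopy starts and ends.\<close>

lemma prism_coord_left:
  "r = sum t {..<i} \<Longrightarrow> prism_coord i r t = simplical_face i t"
  by (auto simp: prism_coord_def simplical_face_def fun_eq_iff)

lemma prism_coord_right:
  "r = sum t {..<Suc i} \<Longrightarrow> prism_coord i r t = simplical_face (Suc i) t"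
  by (auto simp: prism_coord_def simplical_face_def fun_eq_iff less_Suc_eq)

lemma sum_lessThan_simplex_mono:
  assumes "t \<in> standard_simplex n" "i \<le> j"
  shows "sum t {..<i} \<le> sum t {..<j}"
  using assms by (intro sum_mono2) (auto simp: standard_simplex_def)

lemma prism_index_exists:
  assumes t: "t \<in> standard_simplex n" and r: "0 \<le> r" "r \<le> 1"
  obtains i where "i \<le> n" "sum t {..<i} \<le> r" "r \<le> sum t {..<Suc i}"
proof -
  \<comment> \<open>The first interval that ends at or beyond \<open>r\<close>; minimality forces it
    to start at or before \<open>r\<close>.\<close>
  define i where "i = (LEAST i. r \<le> sum t {..<Suc i})"
  have n: "r \<le> sum t {..<Suc n}"
    using t r by (simp add: standard_simplex_def lessThan_Suc_atMost del: sum.lessThan_Suc)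
  have "sum t {..<i} \<le> r"
  proof (cases i)
    case (Suc k)
    then have "\<not> r \<le> sum t {..<Suc k}"
      using not_less_Least[of k "\<lambda>i. r \<le> sum t {..<Suc i}"] unfolding i_def by simp
    then show ?thesis using Suc by simp
  qed (use r in simp)
  moreover have "i \<le> n" unfolding i_def using n by (rule Least_le)
  moreover have "r \<le> sum t {..<Suc i}"
    unfolding i_def using n by (rule LeastI)
  ultimately show ?thesis using that by blast
qed

text \<open>Viewed as one-object categories without identities, the semigroups have functors
  \<open>f\<close> and \<open>g\<close> between them, and \<eta> is the single component of a
  natural transformation.\<close>

locale semigroup_transformation =
  fixes A :: "'a set" and m :: "'a \<Rightarrow> 'a \<Rightarrow> 'a" and B :: "'b set" and n :: "'b \<Rightarrow> 'b \<Rightarrow> 'b"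
    and f g :: "'a \<Rightarrow> 'b" and \<eta> :: 'b
  assumes A: "is_semigroup A m" and B: "is_semigroup B n"
    and f: "semigroup_hom A m B n f" and g: "semigroup_hom A m B n g"
    and \<eta>: "\<eta> \<in> B" and natural: "\<And>x. x \<in> A \<Longrightarrow> n (f x) \<eta> = n \<eta> (g x)"
begin

abbreviation "label \<equiv> prism_label f g \<eta>"

lemma label_in_lists: "xs \<in> lists A \<Longrightarrow> label i xs \<in> lists B"
  using f g \<eta> unfolding prism_label_def
  by (auto 0 3 simp: semigroup_hom_def Pi_iff dest!: in_set_takeD in_set_dropD)

text \<open>The face acts only to the left of \<eta>, where \<open>f\<close> is multiplicative. That
  side loses one entry, hence \<open>Suc i\<close> against \<open>i\<close>.\<close>

lemma face_label_le:
  assumes xs: "xs \<in> lists A" and "1 \<le> length xs" and "k \<le> i" "i < length xs"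
  shows "face n k (label (Suc i) xs) = label i (face m k xs)"
proof -
  have "k \<le> length xs" using assms by simp
  with \<open>1 \<le> length xs\<close> show ?thesis
  proof (cases rule: face_cases)
    case (first x ys)
    then show ?thesis by (simp add: prism_label_def face_0)
  next
    case (last x ys)
    then show ?thesis using assms by simp
  next
    case (mid x y ys zs)
    then obtain d where i: "i = Suc (length ys + d)"
      using \<open>k \<le> i\<close> by (metis add_Suc le_Suc_ex)
    have "f (m x y) = n (f x) (f y)" using f xs mid by (simp add: semigroup_hom_def)
    then show ?thesis
      using face_mid[of n "map f ys" "f x" "f y" "map f (take d zs) @ \<eta> # map g (drop d zs)"]
      by (simp add: prism_label_def mid i face_mid)
  qed
qed

text \<open>The face acts only to the right of \<eta>, where \<open>g\<close> is multiplicative. The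
  place taken by \<eta> accounts for \<open>Suc k\<close>.\<close>

lemma face_label_gt:
  assumes xs: "xs \<in> lists A" and "1 \<le> length xs" and "i < k" "k \<le> length xs"
  shows "face n (Suc k) (label i xs) = label i (face m k xs)"
  using \<open>1 \<le> length xs\<close> \<open>k \<le> length xs\<close>
proof (cases rule: face_cases)
  case (first x ys)
  then show ?thesis using assms by simp
next
  case (last x ys)
  then show ?thesis
    using \<open>i < k\<close> face_last[of n "map f (take i ys) @ \<eta> # map g (drop i ys)" "g x"]
    by (simp add: prism_label_def face_last)
next
  case (mid x y ys zs)
  have "g (m x y) = n (g x) (g y)" using g xs mid by (simp add: semigroup_hom_def)
  then show ?thesis
    using \<open>i < k\<close> mid
      face_mid[of n "map f (take i ys) @ \<eta> # map g (drop i ys)" "g x" "g y" "map g zs"]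
    by (simp add: prism_label_def face_mid)
qed

text \<open>This face merges \<eta> with a neighbour: a value of \<open>g\<close> on its right in
  one label, a value of \<open>f\<close> on its left in the other. Naturality equates the two
  products.\<close>

lemma face_label_diag:
  assumes xs: "xs \<in> lists A" and "i < length xs"
  shows "face n (Suc i) (label i xs) = face n (Suc i) (label (Suc i) xs)"
proof -
  have x: "xs ! i \<in> A" using assms by (metis in_listsD nth_mem)
  have "label i xs = map f (take i xs) @ \<eta> # g (xs ! i) # map g (drop (Suc i) xs)"
    using assms(2) by (simp add: prism_label_def flip: Cons_nth_drop_Suc)
  moreover have "label (Suc i) xs = map f (take i xs) @ f (xs ! i) # \<eta> # map g (drop (Suc i) xs)"
    using assms(2) by (simp add: prism_label_def take_Suc_conv_app_nth)
  ultimately show ?thesis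
    using face_mid[of n "map f (take i xs)"] assms(2) natural[OF x] by simp
qed

section \<open>Gluing the prisms to a homotopy\<close>

abbreviation cell :: "nat \<Rightarrow> real \<Rightarrow> 'a list \<Rightarrow> (nat \<Rightarrow> real) \<Rightarrow> ('b list \<times> (nat \<Rightarrow> real)) set" where
  "cell i r xs t \<equiv> realization_class B n (label i xs, prism_coord i r t)"

lemma realization_class_label_face:
  assumes "xs \<in> lists A" "k \<le> Suc (length xs)" "t \<in> standard_simplex (length xs)"
  shows "realization_class B n (label i xs, simplical_face k t) =
    realization_class B n (face n k (label i xs), t)"
  using realization_class_face[OF B label_in_lists[OF assms(1)], of i k t] assms by simp

text \<open>At the common endpoint the points of both prisms lie on face \<open>Suc i\<close>, and
  \<open>face_label_diag\<close> identifies these faces.\<close>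

lemma cell_step:
  assumes "xs \<in> lists A" "t \<in> standard_simplex (length xs)" "i < length xs" "r = sum t {..<Suc i}"
  shows "cell i r xs t = cell (Suc i) r xs t"
  using assms realization_class_label_face[of xs "Suc i" t] face_label_diag[of xs i]
  by (simp add: prism_coord_left prism_coord_right del: sum.lessThan_Suc)

lemma cell_unique_le:
  assumes xs: "xs \<in> lists A" and t: "t \<in> standard_simplex (length xs)" and "i \<le> j" "j \<le> length xs"
    and r: "r \<le> sum t {..<Suc i}" "sum t {..<j} \<le> r"
  shows "cell i r xs t = cell j r xs t"
  using \<open>i \<le> j\<close> \<open>j \<le> length xs\<close> r
proof (induction j rule: dec_induct)
  case (step k)
  have "sum t {..<Suc i} \<le> sum t {..<Suc k}" "sum t {..<k} \<le> sum t {..<Suc k}"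
    using step by (simp_all only: sum_lessThan_simplex_mono[OF t] Suc_le_mono le_SucI order_refl)
  \<comment> \<open>Monotonicity squeezes \<open>r\<close>: it is at most
    \<open>sum t {..<Suc i}\<close>, hence at most \<open>sum t {..<Suc k}\<close>, which is at most
    \<open>r\<close>.\<close>
  then have "r = sum t {..<Suc k}" "sum t {..<k} \<le> r" using step.prems by auto
  then show ?case using step cell_step[OF xs t, of k r] by simp
qed simp

lemma cell_unique:
  assumes "xs \<in> lists A" "t \<in> standard_simplex (length xs)" "i \<le> length xs" "j \<le> length xs"
    and "sum t {..<i} \<le> r" "r \<le> sum t {..<Suc i}" "sum t {..<j} \<le> r" "r \<le> sum t {..<Suc j}"
  shows "cell i r xs t = cell j r xs t"
  using cell_unique_le[of xs t i j r] cell_unique_le[of xs t j i r] assms nle_le[of i j]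
  by metis

text \<open>On simplices over A the choice of index is harmless: by \<open>cell_unique\<close> all
  admissible indices give the same point.\<close>

definition prism_map :: "real \<times> 'a list \<times> (nat \<Rightarrow> real) \<Rightarrow> ('b list \<times> (nat \<Rightarrow> real)) set" where
  "prism_map = (\<lambda>(r, xs, t).
     cell (SOME i. i \<le> length xs \<and> sum t {..<i} \<le> r \<and> r \<le> sum t {..<Suc i}) r xs t)"

lemma prism_map_eq:
  assumes "xs \<in> lists A" "t \<in> standard_simplex (length xs)" "i \<le> length xs"
    and "sum t {..<i} \<le> r" "r \<le> sum t {..<Suc i}"
  shows "prism_map (r, xs, t) = cell i r xs t"
proof -
  let ?P = "\<lambda>i. i \<le> length xs \<and> sum t {..<i} \<le> r \<and> r \<le> sum t {..<Suc i}"
  have "?P (Eps ?P)" using assms by (intro someI[of ?P i]) simp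
  then have "cell (Eps ?P) r xs t = cell i r xs t"
    using cell_unique[OF assms(1,2) _ assms(3)] assms(4,5) by blast
  then show ?thesis by (simp only: prism_map_def prod.case)
qed

text \<open>An admissible index \<open>i\<close> for the face gives one for the whole tuple:
  \<open>Suc i\<close> if the inserted empty interval comes at or before it, \<open>i\<close>
  otherwise.\<close>

lemma prism_map_face:
  assumes xs: "xs \<in> lists A" and len: "1 \<le> length xs" "k \<le> length xs"
    and t: "t \<in> standard_simplex (length xs - 1)" and r: "0 \<le> r" "r \<le> 1"
  shows "prism_map (r, face m k xs, t) = prism_map (r, xs, simplical_face k t)"
proof -
  obtain i where i: "i \<le> length xs - 1" "sum t {..<i} \<le> r" "r \<le> sum t {..<Suc i}"
    using prism_index_exists[OF t r] .
  have u: "prism_coord i r t \<in> standard_simplex (length xs)"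
    using prism_coord_in_simplex[OF t i] len by (simp flip: Suc_diff_le)
  have ft: "simplical_face k t \<in> standard_simplex (length xs)"
    using simplical_face_in_standard_simplex len t by simp
  have lhs: "prism_map (r, face m k xs, t) = cell i r (face m k xs) t"
    using i t len face_in_lists[OF A xs len] by (intro prism_map_eq) (simp_all add: length_face)
  show ?thesis
  proof (cases "k \<le> i")
    case True
    have "prism_map (r, xs, simplical_face k t) = cell (Suc i) r xs (simplical_face k t)"
      using i len ft xs True
      by (intro prism_map_eq) (auto simp: sum_simplical_face simp del: sum.lessThan_Suc)
    also have "\<dots> = realization_class B n (face n k (label (Suc i) xs), prism_coord i r t)"
      unfolding prism_coord_face_le[OF True]
      using len by (intro realization_class_label_face xs u) auto
    finally show ?thesis using lhs face_label_le[OF xs _ True] i len by simp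
  next
    case False
    have "prism_map (r, xs, simplical_face k t) = cell i r xs (simplical_face k t)"
      using i len ft xs False
      by (intro prism_map_eq) (auto simp: sum_simplical_face simp del: sum.lessThan_Suc)
    also have "\<dots> = realization_class B n (face n (Suc k) (label i xs), prism_coord i r t)"
      unfolding prism_coord_face_gt[OF False[unfolded not_le]]
      using len by (intro realization_class_label_face xs u) auto
    finally show ?thesis using lhs face_label_gt[OF xs _ _ len(2), of i] False len by simp
  qed
qed

lemma prism_map_0:
  assumes "xs \<in> lists A" "t \<in> standard_simplex (length xs)"
  shows "prism_map (0, xs, t) = realization_class B n (map g xs, t)"
proof -
  \<comment> \<open>At time 0 the label \<eta> comes first, after an empty interval, so face 0
    deletes it and only values of \<open>g\<close> remain.\<close>
  have "prism_map (0, xs, t) = cell 0 0 xs t"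
    using assms by (intro prism_map_eq) (auto simp: standard_simplex_def)
  then show ?thesis
    using realization_class_label_face[OF assms(1) _ assms(2), of 0 0]
    by (simp add: prism_coord_left) (simp add: prism_label_def face_0)
qed

lemma prism_map_1:
  assumes "xs \<in> lists A" "t \<in> standard_simplex (length xs)"
  shows "prism_map (1, xs, t) = realization_class B n (map f xs, t)"
proof -
  let ?l = "length xs"
  have 1: "1 = sum t {..<Suc ?l}"
    using assms(2) by (simp add: standard_simplex_def lessThan_Suc_atMost del: sum.lessThan_Suc)
  \<comment> \<open>At time 1 the label \<eta> comes last, before an empty interval, so the last
    face deletes it and only values of \<open>f\<close> remain.\<close>
  have "prism_map (1, xs, t) = cell ?l 1 xs t"
    using assms sum_lessThan_simplex_mono[OF assms(2), of ?l "Suc ?l"] 1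
    by (intro prism_map_eq) auto
  then show ?thesis
    using realization_class_label_face[OF assms(1) _ assms(2), of "Suc ?l" ?l]
      face_last[of n "map f xs" \<eta>]
    by (simp add: prism_coord_right[OF 1]) (simp add: prism_label_def)
qed

text \<open>The prisms form a finite closed cover of [0,1] times the simplex, and the continuous
  maps on them agree on overlaps by \<open>cell_unique\<close>.\<close>

lemma continuous_prism_map_component:
  assumes xs: "xs \<in> lists A"
  shows "continuous_map
    (prod_topology (top_of_set {0..1}) (subtopology (powertop_real UNIV) (standard_simplex (length xs))))
    (classifying_space B n) (\<lambda>p. prism_map (fst p, (xs, snd p)))"
    (is "continuous_map ?X _ _")
proof -
  let ?T = "\<lambda>i. {p \<in> topspace ?X. sum (snd p) {..<i} \<le> fst p \<and> fst p \<le> sum (snd p) {..<Suc i}}"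
  have top: "p \<in> topspace ?X \<longleftrightarrow> fst p \<in> {0..1} \<and> snd p \<in> standard_simplex (length xs)" for p
    by (cases p) (auto simp: topspace_standard_simplex)
  have fst: "continuous_map ?X euclideanreal fst"
    using continuous_map_fst continuous_map_into_fulltopology by blast
  have coord: "continuous_map ?X euclideanreal (\<lambda>p. snd p j)" for j
  proof -
    have "continuous_map ?X (powertop_real UNIV) snd"
      using continuous_map_snd continuous_map_into_fulltopology by blast
    then show ?thesis by (simp add: continuous_map_componentwise_UNIV)
  qed
  have sum: "continuous_map ?X euclideanreal (\<lambda>p. sum (snd p) {..<i})" for i
    by (intro continuous_map_sum coord) simp
  have closed_le: "closedin ?X {p \<in> topspace ?X. u p \<le> v p}"
    if u: "continuous_map ?X euclideanreal u" and v: "continuous_map ?X euclideanreal v" for u v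
    using closedin_continuous_map_preimage[OF continuous_map_diff[OF u v], of "{..0}"] by simp
  show ?thesis
  proof (rule pasting_lemma_closed[where I = "{..length xs}" and T = ?T
        and f = "\<lambda>i p. cell i (fst p) xs (snd p)"])
    fix i assume i: "i \<in> {..length xs}"
    have "closedin ?X {p \<in> topspace ?X. sum (snd p) {..<i} \<le> fst p}"
      "closedin ?X {p \<in> topspace ?X. fst p \<le> sum (snd p) {..<Suc i}}"
      by (intro closed_le fst sum)+
    then have "closedin ?X ({p \<in> topspace ?X. sum (snd p) {..<i} \<le> fst p}
        \<inter> {p \<in> topspace ?X. fst p \<le> sum (snd p) {..<Suc i}})"
      by (rule closedin_Int)
    then show "closedin ?X (?T i)"
      by (rule back_subst[of "closedin ?X"]) auto
    have "continuous_map ?X (powertop_real UNIV) (\<lambda>p. prism_coord i (fst p) (snd p))"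
      unfolding continuous_map_componentwise_UNIV
    proof
      fix j
      show "continuous_map ?X euclideanreal (\<lambda>p. prism_coord i (fst p) (snd p) j)"
        unfolding prism_coord_def
        using coord[of j] coord[of "j - 1"] continuous_map_diff[OF fst sum[of i]]
          continuous_map_diff[OF sum[of "Suc i"] fst]
        by (cases "j < i"; cases "j = i"; cases "j = Suc i") simp_all
    qed
    then have "continuous_map (subtopology ?X (?T i))
        (subtopology (powertop_real UNIV) (standard_simplex (length (label i xs))))
        (\<lambda>p. prism_coord i (fst p) (snd p))"
      using i prism_coord_in_simplex[of _ "length xs" i]
      by (auto simp: continuous_map_in_subtopology top simp del: topspace_prod_topology
          intro!: continuous_map_from_subtopology)
    from continuous_map_compose[OF continuous_map_compose[OF this
          continuous_map_component_injection[OF label_in_lists[OF xs, of i],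
            of "\<lambda>xs. subtopology (powertop_real UNIV) (standard_simplex (length xs))"]]
        quotient_imp_continuous_map[OF quotient_map_realization_class[of B n], unfolded simplices_top_def]]
    show "continuous_map (subtopology ?X (?T i)) (classifying_space B n)
        (\<lambda>p. cell i (fst p) xs (snd p))"
      by (simp add: o_def)
  next
    fix i j p assume "i \<in> {..length xs}" "j \<in> {..length xs}" "p \<in> topspace ?X \<inter> ?T i \<inter> ?T j"
    then show "cell i (fst p) xs (snd p) = cell j (fst p) xs (snd p)"
      by (intro cell_unique xs) (auto simp: top simp del: topspace_prod_topology)
  next
    fix p assume p: "p \<in> topspace ?X"
    then obtain i where "i \<le> length xs" "sum (snd p) {..<i} \<le> fst p" "fst p \<le> sum (snd p) {..<Suc i}"
      using prism_index_exists[of "snd p" "length xs" "fst p"] unfolding top by auto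
    then show "\<exists>i. i \<in> {..length xs} \<and> p \<in> ?T i
        \<and> prism_map (fst p, (xs, snd p)) = cell i (fst p) xs (snd p)"
      using p xs prism_map_eq[of xs "snd p" i "fst p"] by (auto simp: topspace_standard_simplex)
  qed simp
qed

lemma continuous_prism_map:
  "continuous_map (prod_topology (top_of_set {0..1}) (simplices_top A)) (classifying_space B n) prism_map"
  unfolding simplices_top_def
  by (rule continuous_map_from_prod_sum) (rule continuous_prism_map_component)

lemma prism_map_cong:
  assumes "realization_class A m p = realization_class A m p'" "r \<in> {0..1}"
    "p \<in> topspace (simplices_top A)" "p' \<in> topspace (simplices_top A)"
  shows "prism_map (r, p) = prism_map (r, p')"
proof (rule realization_rel_cong[where h = "\<lambda>p. prism_map (r, p)"])
  show "(p, p') \<in> realization_rel A m"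
    using assms realization_class_eq_iff[OF A] by blast
qed (rule prism_map_face; use assms(2) in simp)

text \<open>The product of a quotient map with the identity of a locally compact Hausdorff space is
  a quotient map, so \<open>prism_map\<close> descends to [0,1] times the realization.\<close>

theorem homotopic_realization_maps:
  "homotopic_with (\<lambda>_. True) (classifying_space A m) (classifying_space B n)
     (realization_map B n g) (realization_map B n f)"
proof -
  let ?I = "top_of_set {0..1::real}"
  have "locally_compact_space ?I"
    using compact_space_subtopology[of euclidean "{0..1::real}"] compact_imp_locally_compact_space
    by (metis compact_Icc compactin_euclidean_iff)
  moreover have "Hausdorff_space ?I"
    using Hausdorff_space_euclidean by (rule Hausdorff_space_subtopology)
  ultimately have "quotient_map (prod_topology ?I (simplices_top A))
      (prod_topology ?I (classifying_space A m)) (\<lambda>(r, p). (r, realization_class A m p))"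
    by (intro quotient_map_prod_right quotient_map_realization_class) auto
  then obtain h where
    h: "continuous_map (prod_topology ?I (classifying_space A m)) (classifying_space B n) h"
    and h_eq: "\<And>p. p \<in> topspace (prod_topology ?I (simplices_top A)) \<Longrightarrow>
      h ((\<lambda>(r, p). (r, realization_class A m p)) p) = prism_map p"
  proof (rule quotient_map_lift_exists[OF _ continuous_prism_map])
    fix p p'
    assume "p \<in> topspace (prod_topology ?I (simplices_top A))"
      "p' \<in> topspace (prod_topology ?I (simplices_top A))"
      "(\<lambda>(r, p). (r, realization_class A m p)) p = (\<lambda>(r, p). (r, realization_class A m p)) p'"
    then show "prism_map p = prism_map p'"
      using prism_map_cong[of "snd p" "snd p'" "fst p"] by (cases p; cases p') simp
  qed blast
  have ends: "h (0, c) = realization_map B n g c \<and> h (1, c) = realization_map B n f c"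
    if c: "c \<in> topspace (classifying_space A m)" for c
  proof -
    obtain xs t where p: "c = realization_class A m (xs, t)" "(xs, t) \<in> topspace (simplices_top A)"
      using c by (auto simp: topspace_classifying_space simp del: Image_singleton_iff)
    then have "xs \<in> lists A" "t \<in> standard_simplex (length xs)"
      by (auto simp: topspace_simplices_top)
    then show ?thesis
      using h_eq[of "(0, xs, t)"] h_eq[of "(1, xs, t)"] p(2)
        realization_map_class[OF A B g p(2)] realization_map_class[OF A B f p(2)]
      unfolding p(1) by (simp add: prism_map_0 prism_map_1)
  qed
  show ?thesis
    using h ends by (subst homotopic_with) auto
qed

end

subsection \<open>The group retract of a \<open>K\<close>-thin semigroup\<close>

lemma minimal_ideal:
  assumes S: "is_semigroup A m" and "finite A" "A \<noteq> {}"
  shows "is_ideal A m (minimal_ideal A m)" "minimal_ideal A m \<noteq> {}"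
proof -
  have "is_ideal A m A \<and> A \<noteq> {}"
    using S \<open>A \<noteq> {}\<close> by (simp add: is_ideal_def is_semigroup_def)
  \<comment> \<open>An ideal of least cardinality lies in every nonempty ideal: the intersection
    contains a product of their elements, and it is an ideal that cannot be smaller.\<close>
  then obtain M where M: "is_ideal A m M" "M \<noteq> {}"
    and least: "\<And>I. is_ideal A m I \<Longrightarrow> I \<noteq> {} \<Longrightarrow> card M \<le> card I"
    using ex_has_least_nat[of "\<lambda>I. is_ideal A m I \<and> I \<noteq> {}" A card] by blast
  have "M \<subseteq> I" if I: "is_ideal A m I" "I \<noteq> {}" for I
  proof -
    obtain x y where "x \<in> I" "y \<in> M" using I M by auto
    then have "m x y \<in> I \<inter> M" using I M by (auto simp: is_ideal_def subset_iff)
    moreover have "is_ideal A m (I \<inter> M)" using I M by (auto simp: is_ideal_def)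
    ultimately have "card M \<le> card (I \<inter> M)" using least by blast
    moreover have "finite M" using M \<open>finite A\<close> by (auto simp: is_ideal_def finite_subset)
    ultimately have "I \<inter> M = M" by (intro card_seteq) auto
    then show ?thesis by auto
  qed
  then have "minimal_ideal A m = M"
    using M unfolding minimal_ideal_def by blast
  then show "is_ideal A m (minimal_ideal A m)" "minimal_ideal A m \<noteq> {}" using M by auto
qed

text \<open>For fixed \<open>k\<close> the products \<open>m x k\<close> form a left ideal, hence
  exhaust K, and finiteness makes right multiplication by \<open>k\<close> injective. Cancelling
  \<open>k\<close> shows that an \<open>e\<close> with \<open>m e k = k\<close> is idempotent; it is
  a right identity because every element is some \<open>m y e\<close>.\<close>

lemma left_simple_idempotent:
  assumes S: "is_semigroup K m" and "finite K" "K \<noteq> {}" and simple: "left_simple K m"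
  obtains e where "e \<in> K" "m e e = e" "\<And>x. x \<in> K \<Longrightarrow> m x e = x"
    "\<And>x. x \<in> K \<Longrightarrow> \<exists>y\<in>K. m y x = e"
proof -
  have closed: "m x y \<in> K" if "x \<in> K" "y \<in> K" for x y
    using S that by (simp add: is_semigroup_def)
  have assoc: "m (m x y) z = m x (m y z)" if "x \<in> K" "y \<in> K" "z \<in> K" for x y z
    using S that by (simp add: is_semigroup_def)
  have surj: "(\<lambda>x. m x k) ` K = K" if "k \<in> K" for k
  proof -
    have "m x (m y k) \<in> (\<lambda>x. m x k) ` K" if "x \<in> K" "y \<in> K" for x y
      using that \<open>k \<in> K\<close> by (intro image_eqI[of _ _ "m x y"]) (simp_all add: closed assoc)
    then show ?thesis
      using that \<open>K \<noteq> {}\<close> closed by (intro simple[unfolded left_simple_def, rule_format]) auto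
  qed
  obtain k where k: "k \<in> K" using \<open>K \<noteq> {}\<close> by auto
  then obtain e where e: "e \<in> K" "m e k = k" using surj[OF k] by (metis imageE)
  have "inj_on (\<lambda>x. m x k) K"
    using surj[OF k] \<open>finite K\<close> by (simp add: eq_card_imp_inj_on)
  moreover have "m (m e e) k = m e k" using e k by (simp add: assoc)
  ultimately have ee: "m e e = e" using closed e by (meson inj_onD)
  have "m x e = x" if x: "x \<in> K" for x
  proof -
    obtain y where "y \<in> K" "x = m y e" using surj[OF e(1)] x by (metis imageE)
    then show ?thesis using e ee by (simp add: assoc)
  qed
  moreover have "\<exists>y\<in>K. m y x = e" if "x \<in> K" for x
    using surj[OF that] e(1) by (metis imageE)
  ultimately show ?thesis using that e ee by blast
qed

text \<open>The elements \<open>m (m e x) e\<close> form a group with unit \<open>e\<close>.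
  \<open>one_sided\<close> makes the projection onto it multiplicative and supplies the naturality
  equation that links it to the identity.\<close>

locale group_retract =
  fixes A :: "'a set" and m :: "'a \<Rightarrow> 'a \<Rightarrow> 'a" and e :: 'a
  assumes semigroup: "is_semigroup A m"
    and e: "e \<in> A" "m e e = e"
    and one_sided: "(\<forall>x\<in>A. m (m e x) e = m e x) \<or> (\<forall>x\<in>A. m (m e x) e = m x e)"
    and inverse_exists: "\<And>x. x \<in> A \<Longrightarrow>
      \<exists>y\<in>A. m (m e y) e = y \<and> m y (m (m e x) e) = e \<and> m (m (m e x) e) y = e"

lemma left_simple_group_retract:
  assumes S: "is_semigroup A m" and "finite A" "A \<noteq> {}" and simple: "left_simple (minimal_ideal A m) m"
  obtains e where "group_retract A m e"
proof -
  let ?K = "minimal_ideal A m"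
  have ideal: "is_ideal A m ?K" "?K \<noteq> {}" using minimal_ideal assms by blast+
  have KA: "x \<in> A" if "x \<in> ?K" for x using that ideal by (auto simp: is_ideal_def)
  have closed: "m x y \<in> A" if "x \<in> A" "y \<in> A" for x y
    using S that by (simp add: is_semigroup_def)
  have assoc: "m (m x y) z = m x (m y z)" if "x \<in> A" "y \<in> A" "z \<in> A" for x y z
    using S that by (simp add: is_semigroup_def)
  have Kl: "m x y \<in> ?K" "m y x \<in> ?K" if "x \<in> A" "y \<in> ?K" for x y
    using ideal that by (auto simp: is_ideal_def)
  have "is_semigroup ?K m" using Kl KA assoc by (simp add: is_semigroup_def)
  moreover have "finite ?K" using KA \<open>finite A\<close> by (meson finite_subset subsetI)
  ultimately obtain e where e: "e \<in> ?K" "m e e = e" and right: "\<And>x. x \<in> ?K \<Longrightarrow> m x e = x"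
    and inv: "\<And>x. x \<in> ?K \<Longrightarrow> \<exists>y\<in>?K. m y x = e"
    using left_simple_idempotent ideal(2) simple by metis
  have eA: "e \<in> A" using e KA by blast
  have one: "m (m e x) e = m e x" if "x \<in> A" for x
    using right Kl(2)[OF that e(1)] by simp
  have linv: "\<exists>y\<in>?K. m e y = y \<and> m y x = e" if x: "x \<in> ?K" for x
  proof -
    obtain y where y: "y \<in> ?K" "m y x = e" using inv x by blast
    have "m e (m e y) = m e y" "m (m e y) x = e"
      using y e x KA by (simp_all add: assoc flip: assoc[of e e y])
    then show ?thesis using Kl(1)[OF eA y(1)] by blast
  qed
  have "\<exists>y\<in>A. m (m e y) e = y \<and> m y (m (m e x) e) = e \<and> m (m (m e x) e) y = e" if x: "x \<in> A" for x
  proof -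
    let ?x = "m e x"
    have xK: "?x \<in> ?K" using Kl(2)[OF x e(1)] .
    obtain y where y: "y \<in> ?K" "m e y = y" "m y ?x = e" using linv[OF xK] by blast
    obtain z where z: "z \<in> ?K" "m e z = z" "m z y = e" using linv[OF y(1)] by blast
    \<comment> \<open>A left inverse is also a right inverse: \<open>y\<close> has a left inverse
      \<open>z\<close> itself, and \<open>m z y\<close>, being \<open>e\<close>, may be put in
      front.\<close>
    have "m ?x y = m e (m ?x y)"
      using KA e xK y x by (simp add: closed flip: assoc)
    also have "\<dots> = m (m z y) (m ?x y)" using z(3) by simp
    also have "\<dots> = m z (m (m y ?x) y)"
      using z(1) y(1) xK KA closed by (simp only: assoc)
    also have "m (m y ?x) y = y" using y by simp
    finally have "m ?x y = e" using z(3) by simp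
    then show ?thesis
      using y KA one[OF x] right[OF y(1)] by (intro bexI[of _ y]) simp_all
  qed
  then have "group_retract A m e"
    using S eA e(2) one by unfold_locales blast+
  then show ?thesis using that by blast
qed

lemma is_semigroup_opposite: "is_semigroup A m \<Longrightarrow> is_semigroup A (\<lambda>x y. m y x)"
  by (simp add: is_semigroup_def)

lemma minimal_ideal_opposite: "minimal_ideal A (\<lambda>x y. m y x) = minimal_ideal A m"
proof -
  have "is_ideal A (\<lambda>x y. m y x) I \<longleftrightarrow> is_ideal A m I" for I
    by (auto simp: is_ideal_def)
  then show ?thesis by (simp add: minimal_ideal_def)
qed

text \<open>Reversal swaps the alternatives of \<open>one_sided\<close> and keeps the condition on
  inverses up to associativity. This reduces the right-simple case to the left-simple one.\<close>

lemma group_retract_opposite: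
  assumes "group_retract A (\<lambda>x y. m y x) e" "is_semigroup A m"
  shows "group_retract A m e"
proof -
  interpret op: group_retract A "\<lambda>x y. m y x" e by fact
  have assoc: "m e (m x e) = m (m e x) e" if "x \<in> A" for x
    using assms(2) op.e(1) that by (simp add: is_semigroup_def)
  show ?thesis
  proof
    show "(\<forall>x\<in>A. m (m e x) e = m e x) \<or> (\<forall>x\<in>A. m (m e x) e = m x e)"
      using op.one_sided assoc by auto
    show "\<exists>y\<in>A. m (m e y) e = y \<and> m y (m (m e x) e) = e \<and> m (m (m e x) e) y = e"
      if "x \<in> A" for x
      using op.inverse_exists[OF that] that assoc by auto
  qed (use assms(2) op.e in auto)
qed

lemma K_thin_group_retract:
  assumes S: "is_semigroup A m" and fin: "finite A" "A \<noteq> {}" and thin: "K_thin A m"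
  obtains e where "group_retract A m e"
proof (cases "left_simple (minimal_ideal A m) m")
  case True
  show ?thesis by (rule left_simple_group_retract[OF S fin True]) (rule that)
next
  case False
  then have "right_simple (minimal_ideal A m) m" using thin by (simp add: K_thin_def)
  then have "left_simple (minimal_ideal A (\<lambda>x y. m y x)) (\<lambda>x y. m y x)"
    unfolding minimal_ideal_opposite[of A m] left_simple_def right_simple_def .
  from left_simple_group_retract[OF is_semigroup_opposite[OF S] fin this]
  obtain e where "group_retract A (\<lambda>x y. m y x) e" .
  from that[OF group_retract_opposite[OF this S]] show ?thesis .
qed

subsection \<open>The group completion\<close>

lemma Nil_in_gc_words [simp]: "[] \<in> gc_words A"
  and append_in_gc_words [simp]: "u @ v \<in> gc_words A \<longleftrightarrow> u \<in> gc_words A \<and> v \<in> gc_words A"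
  and Cons_in_gc_words [simp]: "(x, b) # u \<in> gc_words A \<longleftrightarrow> x \<in> A \<and> u \<in> gc_words A"
  by (simp_all add: gc_words_def)

lemma gc_step_in_words:
  assumes "is_semigroup A m" "(u, v) \<in> gc_step A m"
  shows "u \<in> gc_words A \<and> v \<in> gc_words A"
  using assms(2)
proof cases
  case (mult u' v' x y)
  moreover have "m x y \<in> A" using mult assms(1) by (simp add: is_semigroup_def)
  ultimately show ?thesis by simp
qed simp

lemma equiv_gc_eq:
  assumes "is_semigroup A m"
  shows "equiv (gc_words A) (gc_eq A m)"
  unfolding gc_eq_def
proof (rule equiv_Id_on_Un_trancl, rule subrelI)
  show "(u, v) \<in> gc_words A \<times> gc_words A" if "(u, v) \<in> gc_step A m" for u v
    using gc_step_in_words[OF assms that] by simp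
qed

lemma gc_eq_cong:
  assumes "(u, v) \<in> gc_eq A m" "\<And>u v. (u, v) \<in> gc_step A m \<Longrightarrow> h u = h v"
  shows "h u = h v"
  by (rule eq_if_Id_on_Un_trancl[where h = h, OF assms(1)[unfolded gc_eq_def]]) (rule assms(2))

lemma gc_step_context:
  assumes "(u, v) \<in> gc_step A m" "p \<in> gc_words A" "q \<in> gc_words A"
  shows "(p @ u @ q, p @ v @ q) \<in> gc_step A m"
  using assms(1)
proof cases
  case (mult u' v' x y)
  then show ?thesis using gc_step.mult[of "p @ u'" A "v' @ q" x y m] assms by simp
next
  case (cancel u' v' x b)
  then show ?thesis using gc_step.cancel[of "p @ u'" A "v' @ q" x b m] assms by simp
qed

context group_retract
begin

section \<open>The retraction and its homotopy to the identity\<close>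

lemma closed: "x \<in> A \<Longrightarrow> y \<in> A \<Longrightarrow> m x y \<in> A"
  using semigroup by (simp add: is_semigroup_def)

lemma assoc: "x \<in> A \<Longrightarrow> y \<in> A \<Longrightarrow> z \<in> A \<Longrightarrow> m (m x y) z = m x (m y z)"
  using semigroup by (simp add: is_semigroup_def)

definition retract :: "'a \<Rightarrow> 'a" where
  "retract x = m (m e x) e"

text \<open>An inverse of \<open>retract x\<close> in the group e A e, not of \<open>x\<close>; the
  condition \<open>retract y = y\<close> places \<open>y\<close> in that group.\<close>

definition retract_inv :: "'a \<Rightarrow> 'a" where
  "retract_inv x = (SOME y. y \<in> A \<and> retract y = y \<and> m y (retract x) = e \<and> m (retract x) y = e)"

lemma retract_in [simp]: "x \<in> A \<Longrightarrow> retract x \<in> A"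
  by (simp add: retract_def closed e)

lemma retract_inv:
  assumes "x \<in> A"
  shows retract_inv_in [simp]: "retract_inv x \<in> A"
    and retract_retract_inv: "retract (retract_inv x) = retract_inv x"
    and retract_inv_left: "m (retract_inv x) (retract x) = e"
    and retract_inv_right: "m (retract x) (retract_inv x) = e"
proof -
  have "\<exists>y. y \<in> A \<and> retract y = y \<and> m y (retract x) = e \<and> m (retract x) y = e"
    using inverse_exists[OF assms] unfolding retract_def by blast
  from someI_ex[OF this]
  show "retract_inv x \<in> A" "retract (retract_inv x) = retract_inv x"
    "m (retract_inv x) (retract x) = e" "m (retract x) (retract_inv x) = e"
    unfolding retract_inv_def by simp_all
qed

lemma retract_unit [simp]:
  assumes "x \<in> A"
  shows "m e (retract x) = retract x" "m (retract x) e = retract x"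
proof -
  have "m e (retract x) = m (m (m e e) x) e"
    unfolding retract_def using assms e(1) by (simp add: assoc closed)
  then show "m e (retract x) = retract x" by (simp add: retract_def e)
  have "m (retract x) e = m (m e x) (m e e)"
    unfolding retract_def using assms e(1) by (simp add: assoc closed)
  then show "m (retract x) e = retract x" by (simp add: retract_def e)
qed

lemma retract_inv_unit [simp]: "x \<in> A \<Longrightarrow> m e (retract_inv x) = retract_inv x"
  by (metis retract_inv_in retract_retract_inv retract_unit(1))

lemma retract_mult:
  assumes "x \<in> A" "y \<in> A"
  shows "retract (m x y) = m (retract x) (retract y)"
  using one_sided
proof
  assume l: "\<forall>x\<in>A. m (m e x) e = m e x"
  have "retract (m x y) = m e (m x y)" using l assms by (simp add: retract_def closed)
  also have "\<dots> = m (m e x) y" using assms e(1) by (simp add: assoc)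
  \<comment> \<open>\<open>e\<close> can be inserted between the factors because
    \<open>m e x\<close> absorbs it on the right.\<close>
  also have "\<dots> = m (m (m e x) e) y" using l assms by simp
  also have "\<dots> = m (m e x) (m e y)" using assms e(1) by (simp add: closed assoc)
  finally show ?thesis using l assms by (simp add: retract_def)
next
  assume r: "\<forall>x\<in>A. m (m e x) e = m x e"
  have "retract (m x y) = m (m x y) e" using r assms by (simp add: retract_def closed)
  also have "\<dots> = m x (m y e)" using assms e(1) by (simp add: assoc)
  also have "\<dots> = m x (m (m e y) e)" using r assms by simp
  also have "\<dots> = m (m x e) (m y e)" using assms e(1) by (simp add: closed assoc)
  finally show ?thesis using r assms by (simp add: retract_def)
qed

lemma semigroup_hom_retract: "semigroup_hom A m A m retract"
  by (simp add: semigroup_hom_def retract_mult)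

text \<open>The alternatives of \<open>one_sided\<close> give transformations in opposite
  directions: \<open>m (retract x) e = m e x\<close> in the first case,
  \<open>m x e = m e (retract x)\<close> in the second.\<close>

lemma homotopic_retract:
  "homotopic_with (\<lambda>_. True) (classifying_space A m) (classifying_space A m)
     (realization_map A m retract) id"
proof -
  let ?X = "classifying_space A m"
  have id: "semigroup_hom A m A m (\<lambda>x. x)"
    by (simp add: semigroup_hom_def)
  have "homotopic_with (\<lambda>_. True) ?X ?X
      (realization_map A m retract) (realization_map A m (\<lambda>x. x))"
    using one_sided
  proof
    assume l: "\<forall>x\<in>A. m (m e x) e = m e x"
    interpret semigroup_transformation A m A m retract "\<lambda>x. x" e
      using l e by unfold_locales
        (simp_all add: semigroup semigroup_hom_retract id retract_def)
    show ?thesis using homotopic_realization_maps by (rule homotopic_with_symD)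
  next
    assume r: "\<forall>x\<in>A. m (m e x) e = m x e"
    have "m e (m x e) = m x e" if "x \<in> A" for x using r that e by (simp add: assoc)
    then interpret semigroup_transformation A m A m "\<lambda>x. x" retract e
      using r e by unfold_locales
        (simp_all add: semigroup semigroup_hom_retract id retract_def)
    show ?thesis by (rule homotopic_realization_maps)
  qed
  then show ?thesis
    by (rule homotopic_with_eq) (auto simp: realization_map_ident[OF semigroup])
qed

section \<open>Multiplication of classes of words\<close>

abbreviation gc_class :: "('a \<times> bool) list \<Rightarrow> ('a \<times> bool) list set" where
  "gc_class w \<equiv> gc_eq A m `` {w}"

lemma gc_step_class:
  assumes "(u, v) \<in> gc_step A m"
  shows "gc_class u = gc_class v"
proof (rule equiv_class_eq[OF equiv_gc_eq[OF semigroup]])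
  show "(u, v) \<in> gc_eq A m" using assms unfolding gc_eq_def by blast
qed

text \<open>All pairs of representatives yield the same class: exchange one factor at a time, since
  steps may be performed inside a longer word.\<close>

lemma gc_mult_class:
  assumes "u \<in> gc_words A" "v \<in> gc_words A"
  shows "gc_mult A m (gc_class u) (gc_class v) = gc_class (u @ v)"
proof -
  note E = equiv_gc_eq[OF semigroup]
  have words: "u' \<in> gc_words A" if "(u, u') \<in> gc_eq A m" for u u'
    using E that by (auto simp: equiv_def)
  have "gc_class (u' @ v') = gc_class (u @ v)"
    if u': "(u, u') \<in> gc_eq A m" and v': "(v, v') \<in> gc_eq A m" for u' v'
  proof -
    have "gc_class (u @ v) = gc_class (u' @ v)"
      by (rule gc_eq_cong[OF u', where h = "\<lambda>u. gc_class (u @ v)"], rule gc_step_class)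
        (use gc_step_context[where p = "[]"] assms in fastforce)
    also have "\<dots> = gc_class (u' @ v')"
      by (rule gc_eq_cong[OF v', where h = "\<lambda>v. gc_class (u' @ v)"], rule gc_step_class)
        (use gc_step_context[where q = "[]"] words[OF u'] in fastforce)
    finally show ?thesis ..
  qed
  moreover have "u \<in> gc_class u" "v \<in> gc_class v"
    using assms equiv_class_self[OF E] by auto
  ultimately show ?thesis unfolding gc_mult_def by blast
qed

lemma gc_carrier_cases:
  assumes "P \<in> gc_carrier A m"
  obtains w where "w \<in> gc_words A" "P = gc_class w"
  using assms[unfolded gc_carrier_def] by (rule quotientE) (rule that)

lemma gc_class_in: "w \<in> gc_words A \<Longrightarrow> gc_class w \<in> gc_carrier A m"
  unfolding gc_carrier_def by (rule quotientI)

lemma is_semigroup_gc: "is_semigroup (gc_carrier A m) (gc_mult A m)"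
  unfolding is_semigroup_def
proof (intro conjI ballI)
  fix P Q assume "P \<in> gc_carrier A m" "Q \<in> gc_carrier A m"
  then show "gc_mult A m P Q \<in> gc_carrier A m"
    by (elim gc_carrier_cases) (simp add: gc_mult_class gc_class_in)
next
  fix P Q R assume "P \<in> gc_carrier A m" "Q \<in> gc_carrier A m" "R \<in> gc_carrier A m"
  then show "gc_mult A m (gc_mult A m P Q) R = gc_mult A m P (gc_mult A m Q R)"
    by (elim gc_carrier_cases) (simp add: gc_mult_class)
qed

abbreviation gc_unit :: "'a \<Rightarrow> ('a \<times> bool) list set" where
  "gc_unit x \<equiv> gc_class [(x, True)]"

lemma semigroup_hom_gc_unit: "semigroup_hom A m (gc_carrier A m) (gc_mult A m) gc_unit"
  unfolding semigroup_hom_def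
proof (intro conjI ballI funcsetI)
  show "gc_unit x \<in> gc_carrier A m" if "x \<in> A" for x
    using that by (simp add: gc_class_in)
next
  fix x y assume xy: "x \<in> A" "y \<in> A"
  then have "gc_class [(x, True), (y, True)] = gc_unit (m x y)"
    using gc_step_class[OF gc_step.mult[of "[]" A "[]" x y m]] by simp
  then show "gc_unit (m x y) = gc_mult A m (gc_unit x) (gc_unit y)"
    using xy by (simp add: gc_mult_class)
qed

section \<open>Evaluation of words in the group e A e\<close>

primrec word_eval :: "('a \<times> bool) list \<Rightarrow> 'a" where
  "word_eval [] = e"
| "word_eval (z # w) = m (if snd z then retract (fst z) else retract_inv (fst z)) (word_eval w)"

lemma word_eval_in: "w \<in> gc_words A \<Longrightarrow> word_eval w \<in> A"
  by (induction w) (auto simp: closed e)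

text \<open>\<open>e\<close> need not be a unit of A, but values of words absorb it; this settles
  the empty word in \<open>word_eval_append\<close>.\<close>

lemma word_eval_unit: "w \<in> gc_words A \<Longrightarrow> m e (word_eval w) = word_eval w"
proof (induction w)
  case (Cons z w)
  obtain x b where z: "z = (x, b)" by fastforce
  let ?y = "if b then retract x else retract_inv x"
  have "m e (m ?y (word_eval w)) = m (m e ?y) (word_eval w)"
    using Cons.prems e(1) by (subst assoc) (auto simp: z word_eval_in)
  also have "m e ?y = ?y" using Cons.prems by (simp add: z)
  finally show ?case by (cases b) (simp_all add: z)
qed (simp add: e)

lemma word_eval_append:
  "u \<in> gc_words A \<Longrightarrow> v \<in> gc_words A \<Longrightarrow> word_eval (u @ v) = m (word_eval u) (word_eval v)"
proof (induction u)
  case (Cons z u)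
  then show ?case by (cases z) (simp add: word_eval_in assoc)
qed (simp add: word_eval_unit)

text \<open>Multiplication steps are respected because \<open>retract\<close> is multiplicative,
  cancellations because \<open>(x, False)\<close> is read as an inverse of
  \<open>retract x\<close>.\<close>

lemma word_eval_gc_step:
  assumes "(u, v) \<in> gc_step A m"
  shows "word_eval u = word_eval v"
  using assms
proof cases
  case (mult u' v' x y)
  then show ?thesis
    by (simp add: word_eval_append closed retract_mult assoc word_eval_in)
next
  case (cancel u' v' x b)
  then show ?thesis
    using word_eval_unit[of v']
    by (cases b)
      (simp_all add: word_eval_append retract_inv_left retract_inv_right word_eval_in flip: assoc)
qed

text \<open>Evaluation is constant on a class, so its image is a singleton and
  \<open>the_elem\<close> returns the common value.\<close>

definition gc_eval :: "('a \<times> bool) list set \<Rightarrow> 'a" where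
  "gc_eval P = the_elem (word_eval ` P)"

lemma gc_eval_class:
  assumes "w \<in> gc_words A"
  shows "gc_eval (gc_class w) = word_eval w"
proof -
  have "word_eval w = word_eval w'" if "w' \<in> gc_class w" for w'
    using that by (auto intro: gc_eq_cong[where h = word_eval, OF _ word_eval_gc_step])
  then have "word_eval ` gc_class w = (\<lambda>_. word_eval w) ` gc_class w"
    by (intro image_cong refl) (rule sym)
  also have "\<dots> = {word_eval w}"
    using equiv_class_self[OF equiv_gc_eq[OF semigroup] assms] by (rule image_constant)
  finally have "word_eval ` gc_class w = {word_eval w}" .
  then show ?thesis by (simp add: gc_eval_def)
qed

lemma semigroup_hom_gc_eval: "semigroup_hom (gc_carrier A m) (gc_mult A m) A m gc_eval"
  unfolding semigroup_hom_def
proof (intro conjI ballI funcsetI)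
  fix P assume "P \<in> gc_carrier A m"
  then show "gc_eval P \<in> A"
    by (elim gc_carrier_cases) (simp add: gc_eval_class word_eval_in)
next
  fix P Q assume "P \<in> gc_carrier A m" "Q \<in> gc_carrier A m"
  then show "gc_eval (gc_mult A m P Q) = m (gc_eval P) (gc_eval Q)"
    by (elim gc_carrier_cases) (simp add: gc_mult_class gc_eval_class word_eval_append)
qed

lemma gc_eval_unit: "x \<in> A \<Longrightarrow> gc_eval (gc_unit x) = retract x"
  by (simp add: gc_eval_class)

lemma gc_unit_mult: "x \<in> A \<Longrightarrow> y \<in> A \<Longrightarrow> gc_unit (m x y) = gc_mult A m (gc_unit x) (gc_unit y)"
  using semigroup_hom_gc_unit by (simp add: semigroup_hom_def)

lemma gc_class_cancel:
  assumes "x \<in> A" "u \<in> gc_words A" "v \<in> gc_words A"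
  shows "gc_class (u @ (x, b) # (x, \<not> b) # v) = gc_class (u @ v)"
  using gc_step_class[OF gc_step.cancel[of u A v x b m]] assms by simp

lemma gc_unit_e: "gc_unit e = gc_class []"
proof -
  \<comment> \<open>An idempotent becomes trivial in a group: e = e e e^-1 = e e^-1 = 1.\<close>
  have "gc_unit e = gc_class ([(e, True)] @ [(e, True), (e, False)])"
    using gc_class_cancel[of e "[(e, True)]" "[]" True] e by simp
  also have "\<dots> = gc_class [(e, True), (e, False)]"
    using gc_step_class[OF gc_step.mult[of "[]" A "[(e, False)]" e e m]] e by simp
  also have "\<dots> = gc_class []" using gc_class_cancel[of e "[]" "[]" True] e by simp
  finally show ?thesis .
qed

lemma gc_unit_retract: "x \<in> A \<Longrightarrow> gc_unit (retract x) = gc_unit x"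
  using e by (simp add: retract_def gc_unit_mult closed gc_unit_e gc_mult_class)

text \<open>In GS the element \<open>e\<close> becomes 1 and \<open>retract x\<close> becomes
  \<open>x\<close>, so \<open>retract_inv x\<close> becomes a left inverse of \<open>x\<close>;
  multiply by the formal inverse on the right.\<close>

lemma gc_unit_retract_inv:
  assumes x: "x \<in> A"
  shows "gc_unit (retract_inv x) = gc_class [(x, False)]"
proof -
  have "gc_class [(retract_inv x, True), (x, True)] = gc_class []"
    using gc_unit_mult[of "retract_inv x" "retract x"] x
    by (simp add: retract_inv_left gc_unit_e gc_unit_retract gc_mult_class)
  then have "gc_mult A m (gc_class [(retract_inv x, True), (x, True)]) (gc_class [(x, False)])
      = gc_mult A m (gc_class []) (gc_class [(x, False)])" by simp
  then have "gc_class [(retract_inv x, True), (x, True), (x, False)] = gc_class [(x, False)]"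
    using x by (simp add: gc_mult_class)
  moreover have "gc_class [(retract_inv x, True), (x, True), (x, False)] = gc_unit (retract_inv x)"
    using gc_class_cancel[of x "[(retract_inv x, True)]" "[]" True] x by simp
  ultimately show ?thesis by simp
qed

text \<open>Every word is equivalent to the one-letter word of its value, so \<open>gc_unit\<close>
  is onto GS and evaluation is a section of it.\<close>

lemma gc_unit_word_eval: "w \<in> gc_words A \<Longrightarrow> gc_unit (word_eval w) = gc_class w"
proof (induction w)
  case (Cons z w)
  obtain x b where z: "z = (x, b)" by fastforce
  then have "x \<in> A" "w \<in> gc_words A" using Cons.prems by auto
  then have "gc_unit (word_eval (z # w)) = gc_mult A m (gc_class [z]) (gc_class w)"
    using Cons.IH
    by (cases b) (simp_all add: z gc_unit_mult word_eval_in gc_unit_retract gc_unit_retract_inv)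
  then show ?case using Cons.prems by (simp add: z gc_mult_class)
qed (simp add: gc_unit_e)

lemma gc_unit_eval: "P \<in> gc_carrier A m \<Longrightarrow> gc_unit (gc_eval P) = P"
  by (elim gc_carrier_cases) (simp add: gc_eval_class gc_unit_word_eval)

text \<open>The composite on BS is induced by \<open>retract\<close>, hence homotopic to the
  identity; the composite on B(GS) is the identity itself.\<close>

lemma classifying_space_homotopy_equivalent:
  "classifying_space A m homotopy_equivalent_space
    classifying_space (gc_carrier A m) (gc_mult A m)"
  unfolding homotopy_equivalent_space_def
proof (intro exI conjI)
  let ?G = "gc_carrier A m" and ?g = "gc_mult A m"
  let ?\<alpha> = "realization_map ?G ?g gc_unit" and ?\<beta> = "realization_map A m gc_eval"
  show \<alpha>: "continuous_map (classifying_space A m) (classifying_space ?G ?g) ?\<alpha>"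
    by (rule continuous_realization_map[OF semigroup is_semigroup_gc semigroup_hom_gc_unit])
  show \<beta>: "continuous_map (classifying_space ?G ?g) (classifying_space A m) ?\<beta>"
    by (rule continuous_realization_map[OF is_semigroup_gc semigroup semigroup_hom_gc_eval])
  show "homotopic_with (\<lambda>_. True) (classifying_space A m) (classifying_space A m) (?\<beta> \<circ> ?\<alpha>) id"
    by (rule homotopic_with_eq[OF homotopic_retract])
      (simp_all add: realization_map_comp[OF semigroup is_semigroup_gc semigroup
          semigroup_hom_gc_unit semigroup_hom_gc_eval gc_eval_unit])
  have "?\<alpha> (?\<beta> c) = c" if c: "c \<in> topspace (classifying_space ?G ?g)" for c
    using realization_map_comp[OF is_semigroup_gc semigroup is_semigroup_gc
        semigroup_hom_gc_eval semigroup_hom_gc_unit gc_unit_eval c]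
      realization_map_ident[OF is_semigroup_gc _ c, of "\<lambda>x. x"] by simp
  then show "homotopic_with (\<lambda>_. True) (classifying_space ?G ?g) (classifying_space ?G ?g) (?\<alpha> \<circ> ?\<beta>) id"
    using continuous_map_compose[OF \<beta> \<alpha>] by (intro homotopic_with_equal) auto
qed

end

theorem theorem7p3:
  fixes A :: "'a set" and m :: "'a \<Rightarrow> 'a \<Rightarrow> 'a"
  assumes "is_semigroup A m" and "finite A" and "A \<noteq> {}" and "K_thin A m"
  shows "classifying_space A m homotopy_equivalent_space
           classifying_space (gc_carrier A m) (gc_mult A m)"
proof -
  obtain e where "group_retract A m e" using K_thin_group_retract[OF assms] .
  then show ?thesis by (rule group_retract.classifying_space_homotopy_equivalent)
qed

end
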